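(* For all non-negative integers $n,k,\ell$, $L_3(n,k,\ell)$ equals the number of partitions of $n$ into $k+2\ell$ distinct parts whose Durfee square has side $k+\ell$.
   Context: For a partition $\lambda_1\ge\lambda_2\ge\cdots$, the side of its Durfee square is the largest integer $i$ with $\lambda_i\ge i$ ($0$ for the empty partition). A two-color partition is a partition each of whose parts is colored red or green; a part of value $a$ colored green is written $a_g$. $\mathcal{L}_3(n)$ is the set of two-color partitions $\lambda_1>\lambda_2>\cdots>\lambda_m$ of $n$ into numerically distinct parts such that each red part $\lambda_i$ with $i<m$ satisfies $\lambda_i-\lambda_{i+1}\ge 3$, each green part $\lambda_i$ with $i<m$ satisfies $\lambda_i-\lambda_{i+1}\ge 4$, and neither $1_g$ nor $2_g$ occurs as a part. $L_3(n,k,\ell)$ is the number of partitions in $\mathcal{L}_3(n)$ with exactly $k$ red and $\ell$ green parts. *)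

theory Defs
  imports Main
begin

(* A partition is the list of its parts in weakly decreasing order. The i-th part
   (counted from 1) of xs is xs ! (i - 1). *)
definition partitions :: "nat \<Rightarrow> nat list set" where
  "partitions n = {xs. sorted_wrt (\<ge>) xs \<and> (\<forall>x\<in>set xs. 0 < x) \<and> sum_list xs = n}"

(* The inserted 0 is the value for the empty partition; for a nonempty one the
   index 1 qualifies. *)
definition durfee_side :: "nat list \<Rightarrow> nat" where
  "durfee_side xs = Max (insert 0 {i. 1 \<le> i \<and> i \<le> length xs \<and> i \<le> xs ! (i - 1)})"

datatype color = Red | Green

(* A two-color partition is the list of pairs (value, color) with weakly decreasing
   values. In general the order of equal values would be ambiguous, but here the values
   are distinct, so each two-color partition is represented by exactly one list. *)
definition L3_set :: "nat \<Rightarrow> (nat \<times> color) list set" where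
  "L3_set n = {ps. map fst ps \<in> partitions n \<and> distinct (map fst ps) \<and>
     (\<forall>i. Suc i < length ps \<and> snd (ps ! i) = Red \<longrightarrow>
        fst (ps ! i) \<ge> fst (ps ! Suc i) + 3) \<and>
     (\<forall>i. Suc i < length ps \<and> snd (ps ! i) = Green \<longrightarrow>
        fst (ps ! i) \<ge> fst (ps ! Suc i) + 4) \<and>
     (1, Green) \<notin> set ps \<and> (2, Green) \<notin> set ps}"

definition L3 :: "nat \<Rightarrow> nat \<Rightarrow> nat \<Rightarrow> nat" where
  "L3 n k l = card {ps \<in> L3_set n.
     length (filter (\<lambda>p. snd p = Red) ps) = k \<and>
     length (filter (\<lambda>p. snd p = Green) ps) = l}"

lemma finite_partitions: "finite (partitions n)"
proof (rule finite_subset)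
  have len: "length xs \<le> sum_list xs" if "\<forall>x\<in>set xs. 0 < x" for xs :: "nat list"
    using that by (induction xs) auto
  show "partitions n \<subseteq> {xs. set xs \<subseteq> {..n} \<and> length xs \<le> n}"
  proof
    fix xs assume "xs \<in> partitions n"
    then have "\<forall>x\<in>set xs. 0 < x" and s: "sum_list xs = n"
      by (simp_all add: partitions_def)
    with len[of xs] member_le_sum_list[of _ xs]
    show "xs \<in> {xs. set xs \<subseteq> {..n} \<and> length xs \<le> n}" by auto
  qed
  show "finite {xs. set xs \<subseteq> {..n} \<and> length xs \<le> n}"
    by (rule finite_lists_length_le) simp
qed

lemma finite_L3_set: "finite (L3_set n)"
proof (rule finite_subset)
  have "UNIV = {Red, Green}"
    using color.exhaust by blast
  then have fin: "finite (UNIV :: color set)"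
    by (metis finite.emptyI finite.insertI)
  show "L3_set n \<subseteq> (\<Union>xs\<in>partitions n. {ps. set ps \<subseteq> set xs \<times> UNIV \<and> length ps = length xs})"
  proof
    fix ps assume "ps \<in> L3_set n"
    then have "map fst ps \<in> partitions n" by (simp add: L3_set_def)
    moreover have "set ps \<subseteq> set (map fst ps) \<times> UNIV" by force
    ultimately show "ps \<in> (\<Union>xs\<in>partitions n. {ps. set ps \<subseteq> set xs \<times> UNIV \<and> length ps = length xs})"
      by (intro UN_I[of "map fst ps"]) simp_all
  qed
  show "finite (\<Union>xs\<in>partitions n. {ps. set ps \<subseteq> set xs \<times> (UNIV :: color set) \<and> length ps = length xs})"
    by (intro finite_UN_I finite_partitions finite_lists_length_eq finite_cartesian_product fin) simp
qed

end

(* Let N = k + l be the number of parts of a two-color partition, a_1 > ... > a_N, and let S be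
   the set of positions of its green parts. Put t_i = a_i - #{j \<in> S. j \<ge> i} - 2 (N - i) + (N - 1).
   The gap conditions on a become t_1 > ... > t_N, the bounds on the smallest part become
   t_N \<ge> N, strictly if N \<in> S, and the total of the t_i is n minus the total of S. Hence appending
   S, in decreasing order, to t_1, ..., t_N yields a partition of n into distinct parts, and the
   partitions arising in this way are those with N + l parts and Durfee square of side N. *)
theory Submission
  imports Defs
begin

section \<open>Decreasing lists and the Durfee square\<close>

lemma sorted_wrt_greater_iff:
  fixes xs :: "'a::linorder list"
  shows "sorted_wrt (>) xs \<longleftrightarrow> sorted_wrt (\<ge>) xs \<and> distinct xs"
  by (induction xs) (auto simp: order.strict_iff_order)

text \<open>Used with d = 0 to compare any entry of a decreasing list with its last one, and with d
  = 3 to bound the parts of a two-color partition from below.\<close>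

lemma Suc_gap_imp_add_mult_diff_le:
  fixes f :: "nat \<Rightarrow> nat"
  assumes "\<And>i. Suc i < N \<Longrightarrow> f (Suc i) + d \<le> f i" and "i \<le> j" and "j < N"
  shows "f j + d * (j - i) \<le> f i"
  using assms(2,3)
proof (induction j rule: dec_induct)
  case (step j)
  then show ?case
    using assms(1)[of j] by (simp add: Suc_diff_le)
qed simp

lemma sorted_wrt_greater_iff_nth_Suc:
  fixes xs :: "nat list"
  shows "sorted_wrt (>) xs \<longleftrightarrow> (\<forall>i. Suc i < length xs \<longrightarrow> xs ! Suc i < xs ! i)"
  by (rule sorted_wrt_iff_nth_Suc_transp) (auto simp: transp_def)

text \<open>By monotonicity, the index N qualifies iff the last entry of \<open>ts\<close> is at
  least N, and no larger index qualifies iff the first entry of \<open>bs\<close>, if any, is at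
  most N.\<close>

lemma durfee_side_append_iff:
  assumes "sorted_wrt (\<ge>) (ts @ bs)" and "length ts = N"
  shows "durfee_side (ts @ bs) = N \<longleftrightarrow> (\<forall>t\<in>set ts. N \<le> t) \<and> (\<forall>b\<in>set bs. b \<le> N)"
proof -
  let ?xs = "ts @ bs"
  let ?I = "insert 0 {i. 1 \<le> i \<and> i \<le> length ?xs \<and> i \<le> ?xs ! (i - 1)}"
  have mono: "?xs ! j \<le> ?xs ! i" if "i \<le> j" "j < length ?xs" for i j
    using assms(1) that by (cases "i = j") (auto simp: sorted_wrt_iff_nth_less)
  have fin: "finite ?I"
    by (rule finite_subset[of _ "{..length ?xs}"]) auto
  have "durfee_side ?xs = N \<longleftrightarrow> N \<in> ?I \<and> (\<forall>i\<in>?I. i \<le> N)"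
    unfolding durfee_side_def using fin by (subst Max_eq_iff) auto
  also have "N \<in> ?I \<longleftrightarrow> (\<forall>t\<in>set ts. N \<le> t)"
  proof
    assume "N \<in> ?I"
    show "\<forall>t\<in>set ts. N \<le> t"
    proof
      fix t assume "t \<in> set ts"
      then obtain i where i: "i < N" "t = ?xs ! i"
        using assms(2) by (auto simp: in_set_conv_nth nth_append)
      then have "?xs ! (N - 1) \<le> t"
        using mono[of i "N - 1"] assms(2) by simp
      moreover have "N \<le> ?xs ! (N - 1)"
        using \<open>N \<in> ?I\<close> i(1) by auto
      ultimately show "N \<le> t" by simp
    qed
  next
    assume "\<forall>t\<in>set ts. N \<le> t"
    \<comment> \<open>For N = 0 this is the inserted 0; otherwise index N belongs to the last entry
      of \<open>ts\<close>.\<close>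
    then show "N \<in> ?I"
      using assms(2) by (cases N) (auto simp: nth_append)
  qed
  also have "(\<forall>i\<in>?I. i \<le> N) \<longleftrightarrow> (\<forall>b\<in>set bs. b \<le> N)"
  proof
    assume le: "\<forall>i\<in>?I. i \<le> N"
    show "\<forall>b\<in>set bs. b \<le> N"
    proof
      fix b assume "b \<in> set bs"
      then obtain i where i: "i < length bs" "b = ?xs ! (N + i)"
        using assms(2) by (auto simp: in_set_conv_nth nth_append)
      \<comment> \<open>Counted from 1, the first entry of \<open>bs\<close> has index N + 1, which
        would qualify.\<close>
      have "\<not> Suc N \<le> ?xs ! N"
      proof
        assume "Suc N \<le> ?xs ! N"
        then have "Suc N \<in> ?I" using i(1) assms(2) by simp
        then show False using le by fastforce
      qed
      moreover have "b \<le> ?xs ! N"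
        using i mono[of N "N + i"] assms(2) by simp
      ultimately show "b \<le> N" by simp
    qed
  next
    assume le: "\<forall>b\<in>set bs. b \<le> N"
    show "\<forall>i\<in>?I. i \<le> N"
    proof (rule ballI, rule ccontr)
      fix i assume "i \<in> ?I" and "\<not> i \<le> N"
      then have "N \<le> i - 1" "i - 1 < length ?xs" "i \<le> ?xs ! (i - 1)"
        by auto
      \<comment> \<open>An index beyond N points into \<open>bs\<close>; both its shift from 1 to 0
        and the N entries of \<open>ts\<close> are taken off.\<close>
      then have i: "i - 1 - N < length bs" "i \<le> bs ! (i - 1 - N)"
        using assms(2) by (auto simp: nth_append)
      then have "bs ! (i - 1 - N) \<le> N"
        using le by (auto intro: nth_mem)
      with i \<open>\<not> i \<le> N\<close> show False by simp
    qed
  qed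
  finally show ?thesis .
qed

section \<open>Cutting a partition below its Durfee square\<close>

text \<open>The common middle ground of both counts: S is read as the set of parts below the Durfee
  square or as the set of positions of green parts. As S lies below N and \<open>ts\<close> above,
  only the value N could occur in both.\<close>

definition split_pairs :: "nat \<Rightarrow> nat \<Rightarrow> nat \<Rightarrow> (nat list \<times> nat set) set" where
  "split_pairs n N l = {(ts, S). length ts = N \<and> sorted_wrt (>) ts \<and> (\<forall>t\<in>set ts. N \<le> t) \<and>
     S \<subseteq> {1..N} \<and> card S = l \<and> (N \<in> S \<longrightarrow> N \<notin> set ts) \<and> sum_list ts + \<Sum>S = n}"

lemma rev_sorted_list_of_set_set:
  fixes bs :: "nat list"
  assumes "sorted_wrt (>) bs"
  shows "rev (sorted_list_of_set (set bs)) = bs"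
proof -
  have "sorted_wrt (<) (rev bs)"
    using assms by (simp add: sorted_wrt_rev)
  then have "sorted_list_of_set (set (rev bs)) = rev bs"
    by (metis sorted_list_of_set.idem_if_sorted_distinct strict_sorted_iff)
  then show ?thesis by simp
qed

text \<open>The partition is cut after its N-th part; the lower piece, being strictly decreasing, is
  determined by its set of entries.\<close>

lemma card_durfee_eq_card_split_pairs:
  "card {xs \<in> partitions n. distinct xs \<and> length xs = N + l \<and> durfee_side xs = N}
    = card (split_pairs n N l)" (is "card ?D = _")
proof -
  let ?f = "\<lambda>xs. (take N xs, set (drop N xs))"
  let ?g = "\<lambda>(ts, S). ts @ rev (sorted_list_of_set S)"
  \<comment> \<open>Serves both directions of the bijection. The order of \<open>bs\<close> is
    stated separately because \<open>set bs\<close> forgets it.\<close>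
  have D_iff: "ts @ bs \<in> ?D \<longleftrightarrow> (ts, set bs) \<in> split_pairs n N l \<and> sorted_wrt (>) bs"
    if "length ts = N" for ts bs
  proof -
    have "ts @ bs \<in> ?D \<longleftrightarrow> sorted_wrt (>) (ts @ bs) \<and> (\<forall>x\<in>set (ts @ bs). 0 < x) \<and>
        sum_list (ts @ bs) = n \<and> length bs = l \<and> (\<forall>t\<in>set ts. N \<le> t) \<and> (\<forall>b\<in>set bs. b \<le> N)"
      using that durfee_side_append_iff[of ts bs N]
      unfolding partitions_def sorted_wrt_greater_iff[of "ts @ bs"] by auto
    also have "\<dots> \<longleftrightarrow> sorted_wrt (>) ts \<and> sorted_wrt (>) bs \<and> (N \<in> set bs \<longrightarrow> N \<notin> set ts) \<and>
        (\<forall>b\<in>set bs. 0 < b \<and> b \<le> N) \<and> (\<forall>t\<in>set ts. N \<le> t) \<and> sum_list ts + sum_list bs = n \<and>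
        length bs = l" (is "?L \<longleftrightarrow> ?R")
    proof
      assume ?L then show ?R by (auto simp: sorted_wrt_append)
    next
      assume R: ?R
      have "b < t" if "t \<in> set ts" "b \<in> set bs" for t b
      proof -
        have "b \<le> N" "N \<le> t" "\<not> (b = N \<and> t = N)" using R that by auto
        then show ?thesis by linarith
      qed
      moreover have "0 < t" if "t \<in> set ts" for t
      proof -
        \<comment> \<open>The bound N \<le> t gives positivity because N = 0 would leave
          \<open>ts\<close> empty.\<close>
        have "0 < N" using that \<open>length ts = N\<close> length_pos_if_in_set by fast
        moreover have "N \<le> t" using R that by blast
        ultimately show ?thesis by simp
      qed
      ultimately show ?L using R by (auto simp: sorted_wrt_append)
    qed
    also have "\<dots> \<longleftrightarrow> (ts, set bs) \<in> split_pairs n N l \<and> sorted_wrt (>) bs"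
    proof -
      have "length bs = card (set bs)" "sum_list bs = \<Sum>(set bs)" if "sorted_wrt (>) bs"
        using that distinct_card[of bs] sum_list_distinct_conv_sum_set[of bs id]
        by (auto simp: sorted_wrt_greater_iff sum.distinct_set_conv_list[where g = "\<lambda>x. x"])
      then show ?thesis
        using that by (auto simp: split_pairs_def)
    qed
    finally show ?thesis .
  qed
  have "bij_betw ?f ?D (split_pairs n N l)"
  proof (rule bij_betw_byWitness[where f' = ?g])
    have in_D: "?f xs \<in> split_pairs n N l \<and> sorted_wrt (>) (drop N xs)" if "xs \<in> ?D" for xs
      using that D_iff[of "take N xs" "drop N xs"] by simp
    show "?f ` ?D \<subseteq> split_pairs n N l"
      using in_D by blast
    show "\<forall>xs\<in>?D. ?g (?f xs) = xs"
      using in_D by (simp add: rev_sorted_list_of_set_set)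
    have fin: "finite S \<and> length ts = N" if "(ts, S) \<in> split_pairs n N l" for ts S
      using that finite_subset[of S "{1..N}"] by (auto simp: split_pairs_def)
    show "\<forall>p\<in>split_pairs n N l. ?f (?g p) = p"
      using fin by fastforce
    show "?g ` split_pairs n N l \<subseteq> ?D"
    proof clarify
      fix ts S assume p: "(ts, S) \<in> split_pairs n N l"
      have "sorted_wrt (>) (rev (sorted_list_of_set S))"
        by (simp add: sorted_wrt_rev)
      then have "ts @ rev (sorted_list_of_set S) \<in> ?D"
        using p fin[OF p] by (subst D_iff) auto
      then show "ts @ rev (sorted_list_of_set S) \<in> partitions n \<and>
          distinct (ts @ rev (sorted_list_of_set S)) \<and>
          length (ts @ rev (sorted_list_of_set S)) = N + l \<and>
          durfee_side (ts @ rev (sorted_list_of_set S)) = N"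
        by blast
    qed
  qed
  then show ?thesis by (rule bij_betw_same_card)
qed

section \<open>Both families described by neighbouring gaps and the last entry\<close>

text \<open>In a strictly decreasing list the lower bound need only be checked at the last entry,
  which is also the only one that can equal N; excluding N there raises the bound by one. Writing
  the last index as \<open>Suc i = N\<close> makes the clause vacuous for N = 0.\<close>

lemma split_pairs_iff:
  "(ts, S) \<in> split_pairs n N l \<longleftrightarrow> length ts = N \<and> S \<subseteq> {1..N} \<and> card S = l \<and>
     (\<forall>i. Suc i < N \<longrightarrow> ts ! Suc i < ts ! i) \<and>
     (\<forall>i. Suc i = N \<longrightarrow> N + of_bool (N \<in> S) \<le> ts ! i) \<and> sum_list ts + \<Sum>S = n"
proof -
  have "(\<forall>t\<in>set ts. N \<le> t) \<and> (N \<in> S \<longrightarrow> N \<notin> set ts) \<longleftrightarrow>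
      (\<forall>i. Suc i = N \<longrightarrow> N + of_bool (N \<in> S) \<le> ts ! i)" (is "?L \<longleftrightarrow> ?R")
    if gap: "\<forall>i. Suc i < N \<longrightarrow> ts ! Suc i < ts ! i" and len: "length ts = N"
  proof
    assume L: ?L
    show ?R
    proof (intro allI impI)
      fix i assume "Suc i = N"
      then have "ts ! i \<in> set ts" using len by auto
      with L show "N + of_bool (N \<in> S) \<le> ts ! i"
        by (cases "N \<in> S") (auto simp: Suc_le_eq order.strict_iff_order)
    qed
  next
    assume R: ?R
    have "N + of_bool (N \<in> S) \<le> t" if t: "t \<in> set ts" for t
    proof -
      obtain i where i: "i < N" "t = ts ! i"
        using t len by (metis in_set_conv_nth)
      \<comment> \<open>The zero summand fits the gap lemma with d = 0.\<close>
      have "ts ! (N - 1) + 0 * (N - 1 - i) \<le> ts ! i"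
        by (rule Suc_gap_imp_add_mult_diff_le[where N = N]) (use gap i in \<open>simp_all add: less_imp_le\<close>)
      moreover have "Suc (N - 1) = N" using i by simp
      then have "N + of_bool (N \<in> S) \<le> ts ! (N - 1)"
        using R by blast
      ultimately show ?thesis using i by simp
    qed
    moreover from this have "N \<le> t" if "t \<in> set ts" for t
      using that by (meson add_leD1)
    ultimately show ?L by fastforce
  qed
  then show ?thesis
    unfolding split_pairs_def sorted_wrt_greater_iff_nth_Suc by auto
qed

text \<open>Any part before the last is at least 3 if red and 4 if green by the gap condition alone,
  so positivity and the exclusion of green 1 and 2 constrain only the last part: at least 1 if red,
  at least 3 if green.\<close>

lemma L3_set_iff:
  "ps \<in> L3_set n \<longleftrightarrow> sum_list (map fst ps) = n \<and>
     (\<forall>i. Suc i < length ps \<longrightarrow>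
       fst (ps ! Suc i) + 3 + of_bool (snd (ps ! i) = Green) \<le> fst (ps ! i)) \<and>
     (\<forall>i. Suc i = length ps \<longrightarrow> 1 + 2 * of_bool (snd (ps ! i) = Green) \<le> fst (ps ! i))"
  (is "_ \<longleftrightarrow> _ \<and> ?gap \<and> ?last")
proof
  assume ps: "ps \<in> L3_set n"
  have ?gap
  proof (intro allI impI)
    fix i assume "Suc i < length ps"
    then show "fst (ps ! Suc i) + 3 + of_bool (snd (ps ! i) = Green) \<le> fst (ps ! i)"
      using ps by (cases "snd (ps ! i)") (auto simp: L3_set_def)
  qed
  moreover have ?last
  proof (intro allI impI)
    fix i assume i: "Suc i = length ps"
    then have mem: "ps ! i \<in> set ps" by auto
    then have "0 < fst (ps ! i)"
      using ps by (auto simp: L3_set_def partitions_def)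
    moreover have "ps ! i \<noteq> (1, Green)" "ps ! i \<noteq> (2, Green)"
      using ps mem by (auto simp: L3_set_def)
    ultimately show "1 + 2 * of_bool (snd (ps ! i) = Green) \<le> fst (ps ! i)"
      by (cases "ps ! i") auto
  qed
  ultimately show "sum_list (map fst ps) = n \<and> ?gap \<and> ?last"
    using ps by (auto simp: L3_set_def partitions_def)
next
  assume R: "sum_list (map fst ps) = n \<and> ?gap \<and> ?last"
  have bound: "1 + 2 * of_bool (snd p = Green) \<le> fst p" if p: "p \<in> set ps" for p
  proof -
    obtain i where i: "i < length ps" "p = ps ! i"
      using p by (metis in_set_conv_nth)
    then consider "Suc i = length ps" | "Suc i < length ps" by linarith
    then show ?thesis
    proof cases
      case 2
      then have "fst (ps ! Suc i) + 3 + of_bool (snd (ps ! i) = Green) \<le> fst (ps ! i)"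
        using R by blast
      then show ?thesis using i by (cases "snd p = Green") auto
    qed (use R i in blast)
  qed
  have "sorted_wrt (>) (map fst ps)"
    unfolding sorted_wrt_greater_iff_nth_Suc
  proof (intro allI impI)
    fix i assume "Suc i < length (map fst ps)"
    then have "fst (ps ! Suc i) + 3 + of_bool (snd (ps ! i) = Green) \<le> fst (ps ! i)"
      using R by simp
    then show "map fst ps ! Suc i < map fst ps ! i"
      using \<open>Suc i < length (map fst ps)\<close> by simp
  qed
  moreover have "\<forall>x\<in>set (map fst ps). 0 < x" "(1, Green) \<notin> set ps" "(2, Green) \<notin> set ps"
    using bound by fastforce+
  moreover have "fst (ps ! Suc i) + 3 \<le> fst (ps ! i)"
    and "snd (ps ! i) = Green \<Longrightarrow> fst (ps ! Suc i) + 4 \<le> fst (ps ! i)" if "Suc i < length ps" for i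
  proof -
    have "fst (ps ! Suc i) + 3 + of_bool (snd (ps ! i) = Green) \<le> fst (ps ! i)"
      using R that by blast
    then show "fst (ps ! Suc i) + 3 \<le> fst (ps ! i)"
      and "snd (ps ! i) = Green \<Longrightarrow> fst (ps ! Suc i) + 4 \<le> fst (ps ! i)"
      by auto
  qed
  ultimately show "ps \<in> L3_set n"
    using R unfolding L3_set_def partitions_def sorted_wrt_greater_iff by blast
qed

section \<open>Green positions and the shift that removes them\<close>

text \<open>Positions are counted from 1 because they become parts of a partition.\<close>

definition greens :: "(nat \<times> color) list \<Rightarrow> nat set" where
  "greens ps = {Suc i | i. i < length ps \<and> snd (ps ! i) = Green}"

lemma greens_subset: "greens ps \<subseteq> {1..length ps}"
  by (auto simp: greens_def)

lemma Suc_mem_greens_iff: "Suc i \<in> greens ps \<longleftrightarrow> i < length ps \<and> snd (ps ! i) = Green"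
  by (auto simp: greens_def)

lemma card_greens: "card (greens ps) = length (filter (\<lambda>p. snd p = Green) ps)"
proof -
  have "greens ps = Suc ` {i. i < length ps \<and> snd (ps ! i) = Green}"
    by (auto simp: greens_def)
  then show ?thesis
    by (simp add: card_image length_filter_conv_card)
qed

lemma length_filter_Red_Green:
  "length (filter (\<lambda>p. snd p = Red) ps) + length (filter (\<lambda>p. snd p = Green) ps) = length ps"
proof -
  have "snd p = Green \<longleftrightarrow> \<not> snd p = Red" for p :: "'a \<times> color"
    by (cases "snd p") simp_all
  then show ?thesis by (simp only: sum_length_filter_compl)
qed

text \<open>With i counted from 0 and S from 1, the strict inequality includes entry i itself. For
  finite S of positive numbers these are the parts of the conjugate of the partition with part set
  S.\<close>

definition above :: "nat set \<Rightarrow> nat \<Rightarrow> nat" where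
  "above S i = card {j \<in> S. i < j}"

lemma above_Suc: "finite S \<Longrightarrow> above S i = above S (Suc i) + of_bool (Suc i \<in> S)"
proof -
  assume "finite S"
  moreover have "{j \<in> S. i < j} = (if Suc i \<in> S then insert (Suc i) {j \<in> S. Suc i < j} else {j \<in> S. Suc i < j})"
    by (auto intro: Suc_lessI)
  ultimately show ?thesis by (simp add: above_def)
qed

lemma above_le: "S \<subseteq> {1..N} \<Longrightarrow> above S i \<le> N - i"
proof -
  assume "S \<subseteq> {1..N}"
  then have "{j \<in> S. i < j} \<subseteq> {i<..N}" by auto
  then have "card {j \<in> S. i < j} \<le> card {i<..N}" by (rule card_mono[rotated]) simp
  then show ?thesis by (simp add: above_def)
qed

text \<open>Double counting: each j in S is counted for exactly the j indices i < j, all of them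
  below N.\<close>

lemma sum_above:
  assumes "S \<subseteq> {1..N}"
  shows "(\<Sum>i<N. above S i) = \<Sum>S"
proof -
  have fin: "finite S" using assms finite_subset by blast
  have "(\<Sum>i<N. above S i) = (\<Sum>i<N. \<Sum>j\<in>S. of_bool (i < j))"
    using fin by (simp add: above_def sum.If_cases of_bool_def Int_def)
  also have "\<dots> = (\<Sum>j\<in>S. \<Sum>i<N. of_bool (i < j))"
    by (rule sum.swap)
  also have "\<dots> = (\<Sum>j\<in>S. j)"
  proof (rule sum.cong)
    fix j assume "j \<in> S"
    then have "{..<N} \<inter> {i. i < j} = {..<j}" using assms by auto
    then show "(\<Sum>i<N. of_bool (i < j)) = j"
      by (simp add: of_bool_def sum.If_cases)
  qed simp
  finally show ?thesis .
qed

lemma sum_two_mult_diff: "(\<Sum>i<N. 2 * (N - 1 - i)) = N * (N - (1::nat))"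
proof -
  have "(\<Sum>i<N. 2 * (N - 1 - i)) = (\<Sum>i<N. 2 * i)"
    \<comment> \<open>Reverses the order of summation.\<close>
    by (rule sum.reindex_bij_witness[of _ "\<lambda>i. N - 1 - i" "\<lambda>i. N - 1 - i"]) auto
  also have "\<dots> = N * (N - 1)"
    by (induction N) (auto simp: algebra_simps split: nat_diff_split)
  finally show ?thesis .
qed

(* Lists are indexed from 0 but S holds positions counted from 1. N - 1 is added to a instead of
   subtracted on the right, so that no truncation occurs. *)
definition flattens :: "nat \<Rightarrow> nat set \<Rightarrow> (nat \<Rightarrow> nat) \<Rightarrow> (nat \<Rightarrow> nat) \<Rightarrow> bool" where
  "flattens N S a t \<longleftrightarrow> (\<forall>i<N. a i + (N - 1) = t i + above S i + 2 * (N - 1 - i))"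

text \<open>The N summands N - 1 on the left cancel against the total of the terms
  \<open>2 * (N - 1 - i)\<close>, leaving only the total of \<open>above\<close>.\<close>

lemma flattens_sum:
  assumes "flattens N S a t" and "S \<subseteq> {1..N}"
  shows "(\<Sum>i<N. a i) = (\<Sum>i<N. t i) + \<Sum>S"
proof -
  have "(\<Sum>i<N. a i + (N - 1)) = (\<Sum>i<N. t i + above S i + 2 * (N - 1 - i))"
    using assms(1) by (intro sum.cong) (auto simp: flattens_def)
  then have "(\<Sum>i<N. a i) + N * (N - 1) = (\<Sum>i<N. t i) + \<Sum>S + N * (N - 1)"
    unfolding sum.distrib sum_above[OF assms(2)] sum_two_mult_diff by simp
  then show ?thesis by simp
qed

text \<open>From index i to i + 1 the linear term drops by 2 and \<open>above\<close> drops by 1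
  exactly at a green part, so a gap of 3 or 4 in a becomes a gap of 1 in t.\<close>

lemma flattens_gap_iff:
  assumes "flattens N S a t" and "S \<subseteq> {1..N}" and "Suc i < N"
  shows "a (Suc i) + 3 + of_bool (Suc i \<in> S) \<le> a i \<longleftrightarrow> t (Suc i) < t i"
proof -
  have "finite S" using assms(2) finite_subset by blast
  then have "above S i = above S (Suc i) + of_bool (Suc i \<in> S)" by (rule above_Suc)
  moreover have "a i + (N - 1) = t i + above S i + 2 * (N - 1 - i)"
    and "a (Suc i) + (N - 1) = t (Suc i) + above S (Suc i) + 2 * (N - 1 - Suc i)"
    using assms by (auto simp: flattens_def)
  ultimately show ?thesis using assms(3) by linarith
qed

text \<open>At the last index the linear term vanishes and \<open>above\<close> is 1 or 0 according
  to the color, so a green last part satisfies a = t - N + 2 and a red one a = t - N + 1.\<close>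

lemma flattens_last_iff:
  assumes "flattens N S a t" and "S \<subseteq> {1..N}" and "Suc i = N"
  shows "1 + 2 * of_bool (N \<in> S) \<le> a i \<longleftrightarrow> N + of_bool (N \<in> S) \<le> t i"
proof -
  have "finite S" using assms(2) finite_subset by blast
  then have "above S i = above S N + of_bool (N \<in> S)"
    using above_Suc assms(3) by blast
  moreover have "above S N = 0"
    using above_le[OF assms(2), of N] by simp
  moreover have "a i + (N - 1) = t i + above S i + 2 * (N - 1 - i)"
    using assms by (auto simp: flattens_def)
  ultimately show ?thesis using assms(3) by linarith
qed

section \<open>The bijection with two-color partitions\<close>

text \<open>The totals, gaps and last entries correspond one by one. Assuming only the relation
  between \<open>ps\<close> and \<open>ts\<close> lets the same equivalence serve the map and its
  inverse.\<close>

lemma L3_set_iff_split_pairs: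
  assumes "flattens (length ps) (greens ps) (\<lambda>i. fst (ps ! i)) ((!) ts)"
    and "length ts = length ps"
  shows "ps \<in> L3_set n \<longleftrightarrow> (ts, greens ps) \<in> split_pairs n (length ps) (card (greens ps))"
proof -
  let ?N = "length ps"
  note sub = greens_subset[of ps]
  have "sum_list (map fst ps) = sum_list ts + \<Sum>(greens ps)"
    using flattens_sum[OF assms(1) sub] assms(2)
    by (simp add: sum_list_sum_nth atLeast0LessThan)
  moreover have "(\<forall>i. Suc i < ?N \<longrightarrow>
       fst (ps ! Suc i) + 3 + of_bool (snd (ps ! i) = Green) \<le> fst (ps ! i)) \<longleftrightarrow>
     (\<forall>i. Suc i < ?N \<longrightarrow> ts ! Suc i < ts ! i)"
    using flattens_gap_iff[OF assms(1) sub] by (simp add: Suc_mem_greens_iff)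
  moreover have "(\<forall>i. Suc i = ?N \<longrightarrow> 1 + 2 * of_bool (snd (ps ! i) = Green) \<le> fst (ps ! i)) \<longleftrightarrow>
     (\<forall>i. Suc i = ?N \<longrightarrow> ?N + of_bool (?N \<in> greens ps) \<le> ts ! i)"
  proof -
    have "?N \<in> greens ps \<longleftrightarrow> snd (ps ! i) = Green" if "Suc i = ?N" for i
      using Suc_mem_greens_iff[of i ps] that by auto
    then show ?thesis
      using flattens_last_iff[OF assms(1) sub] by auto
  qed
  ultimately show ?thesis
    using sub assms(2) unfolding L3_set_iff split_pairs_iff by auto
qed

lemma card_L3_eq_card_split_pairs: "L3 n k l = card (split_pairs n (k + l) l)"
proof -
  define N where "N = k + l"
  define L where "L = {ps \<in> L3_set n. length ps = N \<and> card (greens ps) = l}"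
  \<comment> \<open>\<open>t\<close> and \<open>g\<close> solve the equation of
    \<open>flattens\<close> for either side; \<open>flat_t\<close> and \<open>flat_g\<close> show
    that the subtractions do not truncate.\<close>
  define t where "t ps =
      map (\<lambda>i. fst (ps ! i) + (N - 1) - (above (greens ps) i + 2 * (N - 1 - i))) [0..<N]" for ps
  define g where "g ts S = map (\<lambda>i. (ts ! i + above S i + 2 * (N - 1 - i) - (N - 1),
      if Suc i \<in> S then Green else Red)) [0..<N]" for ts S
  have len_t: "length (t ps) = N" for ps by (simp add: t_def)
  have len_g: "length (g ts S) = N" for ts S by (simp add: g_def)
  have flat_t: "flattens N (greens ps) (\<lambda>i. fst (ps ! i)) ((!) (t ps))" if "ps \<in> L" for ps
    unfolding flattens_def
  proof (intro allI impI)
    fix i assume i: "i < N"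
    have ps: "length ps = N" "ps \<in> L3_set n" using that by (auto simp: L_def)
    have gap: "fst (ps ! Suc i) + 3 \<le> fst (ps ! i)" if "Suc i < N" for i
    proof -
      have "fst (ps ! Suc i) + 3 + of_bool (snd (ps ! i) = Green) \<le> fst (ps ! i)"
        using ps that unfolding L3_set_iff by blast
      then show ?thesis by simp
    qed
    have "fst (ps ! (N - 1)) + 3 * (N - 1 - i) \<le> fst (ps ! i)"
      by (rule Suc_gap_imp_add_mult_diff_le[where N = N]) (use gap i in auto)
    moreover have "1 \<le> fst (ps ! (N - 1))"
    proof -
      have "Suc (N - 1) = length ps" using ps i by simp
      then have "1 + 2 * of_bool (snd (ps ! (N - 1)) = Green) \<le> fst (ps ! (N - 1))"
        using ps unfolding L3_set_iff by blast
      then show ?thesis by simp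
    qed
    moreover have "above (greens ps) i \<le> N - i"
      using greens_subset[of ps] ps by (intro above_le) simp
    \<comment> \<open>As N - i = 1 + (N - 1 - i), the left side is at most 1 + 3 (N - 1 - i), hence
      at most the part at index i.\<close>
    ultimately have "above (greens ps) i + 2 * (N - 1 - i) \<le> fst (ps ! i) + (N - 1)"
      using i by linarith
    then show "fst (ps ! i) + (N - 1) = t ps ! i + above (greens ps) i + 2 * (N - 1 - i)"
      using i by (simp add: t_def)
  qed
  have flat_g: "flattens N S (\<lambda>i. fst (g ts S ! i)) ((!) ts)"
    if "(ts, S) \<in> split_pairs n N l" for ts S
    unfolding flattens_def
  proof (intro allI impI)
    fix i assume i: "i < N"
    \<comment> \<open>This alone covers the subtracted N - 1.\<close>
    then have "N \<le> ts ! i"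
      using that by (auto simp: split_pairs_def)
    then show "fst (g ts S ! i) + (N - 1) = ts ! i + above S i + 2 * (N - 1 - i)"
      using i by (simp add: g_def)
  qed
  have greens_g: "greens (g ts S) = S" if "(ts, S) \<in> split_pairs n N l" for ts S
  proof (rule set_eqI)
    fix j
    have S: "S \<subseteq> {1..N}" using that by (simp add: split_pairs_def)
    show "j \<in> greens (g ts S) \<longleftrightarrow> j \<in> S"
    \<comment> \<open>Positions start at 1, so 0 lies in neither set, and position
      \<open>Suc i\<close> belongs to index i.\<close>
    proof (cases j)
      case 0
      then show ?thesis using S greens_subset[of "g ts S"] by auto
    next
      case (Suc i)
      have "Suc i \<in> S \<Longrightarrow> i < N" using S by auto
      then show ?thesis
        unfolding Suc Suc_mem_greens_iff len_g by (auto simp: g_def split: if_splits)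
    qed
  qed
  have "bij_betw (\<lambda>ps. (t ps, greens ps)) L (split_pairs n N l)"
  proof (rule bij_betw_byWitness[where f' = "\<lambda>(ts, S). g ts S"])
    show "(\<lambda>ps. (t ps, greens ps)) ` L \<subseteq> split_pairs n N l"
    proof (rule image_subsetI)
      fix ps assume ps: "ps \<in> L"
      then have L: "ps \<in> L3_set n" "length ps = N" "card (greens ps) = l"
        by (auto simp: L_def)
      show "(t ps, greens ps) \<in> split_pairs n N l"
        using L3_set_iff_split_pairs[of ps "t ps" n] flat_t[OF ps] len_t[of ps]
        unfolding L(2,3) by (simp add: L)
    qed
    show "(\<lambda>(ts, S). g ts S) ` split_pairs n N l \<subseteq> L"
    proof (rule image_subsetI, clarify)
      fix ts S assume p: "(ts, S) \<in> split_pairs n N l"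
      then have "length ts = N" "card S = l"
        by (auto simp: split_pairs_def)
      then show "g ts S \<in> L"
        using L3_set_iff_split_pairs[of "g ts S" ts n] flat_g[OF p] p
        unfolding L_def len_g greens_g[OF p] by (simp add: len_g greens_g[OF p])
    qed
    show "\<forall>ps\<in>L. (\<lambda>(ts, S). g ts S) (t ps, greens ps) = ps"
    proof
      fix ps assume ps: "ps \<in> L"
      then have len: "length ps = N" by (simp add: L_def)
      have "g (t ps) (greens ps) ! i = ps ! i" if i: "i < N" for i
      proof (rule prod_eqI)
        have "fst (ps ! i) + (N - 1) = t ps ! i + above (greens ps) i + 2 * (N - 1 - i)"
          using flat_t[OF ps] i unfolding flattens_def by blast
        then show "fst (g (t ps) (greens ps) ! i) = fst (ps ! i)"
          using i unfolding g_def by simp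
        show "snd (g (t ps) (greens ps) ! i) = snd (ps ! i)"
          using i len by (cases "snd (ps ! i)") (simp_all add: g_def Suc_mem_greens_iff)
      qed
      then have "g (t ps) (greens ps) = ps"
        by (intro nth_equalityI) (simp_all add: len len_g)
      then show "(\<lambda>(ts, S). g ts S) (t ps, greens ps) = ps" by simp
    qed
    show "\<forall>p\<in>split_pairs n N l. (\<lambda>ps. (t ps, greens ps)) ((\<lambda>(ts, S). g ts S) p) = p"
    proof clarify
      fix ts S assume p: "(ts, S) \<in> split_pairs n N l"
      then have len: "length ts = N" by (auto simp: split_pairs_def)
      have "t (g ts S) = ts"
      proof (rule nth_equalityI)
        fix i assume "i < length (t (g ts S))"
        then have i: "i < N" by (simp add: len_t)
        have "fst (g ts S ! i) + (N - 1) = ts ! i + above S i + 2 * (N - 1 - i)"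
          using flat_g[OF p] i unfolding flattens_def by blast
        moreover have "t (g ts S) ! i = fst (g ts S ! i) + (N - 1) - (above S i + 2 * (N - 1 - i))"
          using i by (simp add: t_def greens_g[OF p])
        ultimately show "t (g ts S) ! i = ts ! i" by linarith
      qed (simp add: len len_t)
      then show "t (g ts S) = ts \<and> greens (g ts S) = S"
        using greens_g[OF p] by simp
    qed
  qed
  then have "card L = card (split_pairs n N l)" by (rule bij_betw_same_card)
  moreover have "{ps \<in> L3_set n. length (filter (\<lambda>p. snd p = Red) ps) = k \<and>
      length (filter (\<lambda>p. snd p = Green) ps) = l} = L"
  proof -
    \<comment> \<open>Every part has one of the two colors, so fixing both color counts amounts to
      fixing the length and the green count.\<close>
    have "length (filter (\<lambda>p. snd p = Red) ps) = k \<and> length (filter (\<lambda>p. snd p = Green) ps) = l \<longleftrightarrow>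
        length ps = N \<and> card (greens ps) = l" for ps :: "(nat \<times> color) list"
      using length_filter_Red_Green[of ps] unfolding card_greens N_def by linarith
    then show ?thesis by (simp add: L_def)
  qed
  ultimately show ?thesis by (simp add: L3_def N_def)
qed

theorem theorem1p6:
  fixes n k l :: nat
  shows "L3 n k l = card {xs \<in> partitions n.
    distinct xs \<and> length xs = k + 2 * l \<and> durfee_side xs = k + l}"
  using card_L3_eq_card_split_pairs[of n k l] card_durfee_eq_card_split_pairs[of n "k + l" l]
  \<comment> \<open>With N = k + l, the length k + 2 l is N + l.\<close>
  by (simp add: mult_2 add.assoc)

end
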